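(* Let $G$ be a group, $H$ a subgroup of finite index $[G:H]$ in $G$, and $K$ a normal subgroup of $H$. Let $C$ be a proper subset of $H$ such that $C$ is a union of right cosets of $K$ and $H\setminus C$ is a union of finitely many right cosets of $K$. Assume that the number of right cosets of $K$ contained in $C$ is greater than $2[G:H]$ times the number of right cosets of $K$ contained in $H\setminus C$. Let $E$ be a finite subset of $C$ and $F$ a subset of $H\setminus C$. Suppose that (1) $F$ is a proper subset of $H\setminus C$, and for any $2[G:H]$ elements $x_1,y_1,\dots,x_{[G:H]},y_{[G:H]}$ of $G$ with $x_i\neq y_i$ for every $i$, there exists a finite index subgroup $L$ of $K$ which is normal in $H$ and satisfies $Lx_i\neq Ly_i$ for every $i$; (2) every finite index subgroup $L$ of $K$ has more than $2([G:H]+1)|E|$ elements. Then $(C\setminus E)\cup F$ is not a minimal complement in $G$.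
   Context: For nonempty subsets $A,B$ of a group $G$, write $A\cdot B=\{ab: a\in A, b\in B\}$. $A$ is a left complement to $B$ if $A\cdot B=G$, and a right complement to $B$ if $B\cdot A=G$. $A$ is a minimal left (resp. right) complement to $B$ if $A$ is a left (resp. right) complement to $B$ and no proper subset of $A$ is a left (resp. right) complement to $B$. A subset $A$ of $G$ is a minimal complement in $G$ if it is a minimal left complement or a minimal right complement to some nonempty subset of $G$. *)

theory Defs
  imports "HOL-Algebra.Coset"
begin

text \<open>For subsets \<open>A\<close>, \<open>B\<close> of the carrier of \<open>G\<close>, the product set \<open>A \<cdot> B\<close> is \<^term>\<open>A <#>\<^bsub>G\<^esub> B\<close>.
  ``Left'' refers to the position of \<open>A\<close> in \<open>A \<cdot> B = G\<close>.\<close>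

definition left_complement :: "('a, 'b) monoid_scheme \<Rightarrow> 'a set \<Rightarrow> 'a set \<Rightarrow> bool" where
  "left_complement G A B \<longleftrightarrow>
     A \<subseteq> carrier G \<and> A \<noteq> {} \<and> B \<subseteq> carrier G \<and> B \<noteq> {} \<and> A <#>\<^bsub>G\<^esub> B = carrier G"

definition right_complement :: "('a, 'b) monoid_scheme \<Rightarrow> 'a set \<Rightarrow> 'a set \<Rightarrow> bool" where
  "right_complement G A B \<longleftrightarrow>
     A \<subseteq> carrier G \<and> A \<noteq> {} \<and> B \<subseteq> carrier G \<and> B \<noteq> {} \<and> B <#>\<^bsub>G\<^esub> A = carrier G"

definition minimal_left_complement :: "('a, 'b) monoid_scheme \<Rightarrow> 'a set \<Rightarrow> 'a set \<Rightarrow> bool" where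
  "minimal_left_complement G A B \<longleftrightarrow>
     left_complement G A B \<and> (\<forall>A'. A' \<subset> A \<longrightarrow> \<not> left_complement G A' B)"

definition minimal_right_complement :: "('a, 'b) monoid_scheme \<Rightarrow> 'a set \<Rightarrow> 'a set \<Rightarrow> bool" where
  "minimal_right_complement G A B \<longleftrightarrow>
     right_complement G A B \<and> (\<forall>A'. A' \<subset> A \<longrightarrow> \<not> right_complement G A' B)"

definition minimal_complement :: "('a, 'b) monoid_scheme \<Rightarrow> 'a set \<Rightarrow> bool" where
  "minimal_complement G A \<longleftrightarrow>
     (\<exists>B. minimal_left_complement G A B \<or> minimal_right_complement G A B)"

text \<open>A subgroup \<open>L\<close> of a subgroup \<open>K\<close> of \<open>G\<close> has finite index in \<open>K\<close> if
  \<open>finite_index_subgroup (G\<lparr>carrier := K\<rparr>) L\<close>.\<close>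

definition finite_index_subgroup :: "('a, 'b) monoid_scheme \<Rightarrow> 'a set \<Rightarrow> bool" where
  "finite_index_subgroup G H \<longleftrightarrow> subgroup H G \<and> finite (rcosets\<^bsub>G\<^esub> H)"

text \<open>The index as a natural number; only meaningful if the index is finite.\<close>

definition subgroup_index :: "('a, 'b) monoid_scheme \<Rightarrow> 'a set \<Rightarrow> nat" where
  "subgroup_index G H = card (rcosets\<^bsub>G\<^esub> H)"

definition rcosets_within :: "('a, 'b) monoid_scheme \<Rightarrow> 'a set \<Rightarrow> 'a set \<Rightarrow> 'a set set" where
  "rcosets_within G K S = {D \<in> rcosets\<^bsub>G\<^esub> K. D \<subseteq> S}"

text \<open>Since \<^const>\<open>card\<close> is \<open>0\<close> on infinite sets, ``more than \<open>n\<close> elements'' has to allow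
  for infinite sets explicitly.\<close>

definition more_than :: "'c set \<Rightarrow> nat \<Rightarrow> bool" where
  "more_than S n \<longleftrightarrow> infinite S \<or> card S > n"

end

theory Submission
  imports Defs
begin

text \<open>Let \<open>A = (C - E) \<union> F\<close>, \<open>D = H - C\<close> and \<open>n = [G:H]\<close>. If \<open>A\<close> is a minimal left complement to \<open>B\<close>, every
  \<open>a \<in> A\<close> has a private product \<open>p a = a\<beta>\<close>, lying in no \<open>a'B\<close> with \<open>a' \<in> A - {a}\<close>. There is a set
  \<open>Z\<close> of at most \<open>2n\<close> elements of \<open>B\<close> such that every private product lies in \<open>(D \<union> E)Z\<close>, and
  \<open>DZ\<close> consists of at most \<open>2n\<close> times as many right cosets of \<open>K\<close> as \<open>D\<close>, hence of fewer than
  \<open>C\<close> contains. If a coset \<open>Y\<close> in \<open>DZ\<close> contains private products of elements of two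
  different cosets in \<open>C\<close>, then moving one product to another by an element of \<open>K\<close> shows that
  there are at most \<open>2|E|\<close> of them in \<open>Y\<close>. So the cosets of \<open>C\<close> whose private products avoid
  the unambiguous cosets \<open>Y\<close> outnumber the ambiguous ones, and they contain more elements than
  there are places left for their private products. Right complements reduce to
  left ones by inversion.\<close>

section \<open>Right cosets, private products and translates\<close>

lemma (in group) rcos_mult_left:
  assumes "subgroup K G" "k \<in> K" "a \<in> carrier G"
  shows "K #> (k \<otimes> a) = K #> a"
  using assms by (metis coset_mult_assoc coset_join2 subgroup.mem_carrier subgroup.subset)

lemma (in group) rcos_eqD:
  assumes "subgroup K G" "a \<in> carrier G" "b \<in> carrier G" "K #> a = K #> b"
  obtains k where "k \<in> K" "b = k \<otimes> a"
proof -
  have "b \<in> K #> a" using assms by (metis rcos_self)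
  then show ?thesis using that unfolding r_coset_def by auto
qed

text \<open>Dropping \<open>a\<close> from \<open>A\<close> leaves some \<open>g\<close> uncovered,
  so every factorization of \<open>g\<close> over \<open>A\<close> and \<open>B\<close> starts with
  \<open>a\<close>. The second factor of one of them serves as \<open>\<beta> a\<close>.\<close>

lemma (in group) private_products:
  assumes min: "minimal_left_complement G A B"
  obtains \<beta> where "\<And>a. a \<in> A \<Longrightarrow> \<beta> a \<in> B"
    "\<And>a a' b. \<lbrakk>a \<in> A; a' \<in> A; b \<in> B; a \<otimes> \<beta> a = a' \<otimes> b\<rbrakk> \<Longrightarrow> a' = a"
proof -
  have lc: "left_complement G A B" and mn: "\<And>A'. A' \<subset> A \<Longrightarrow> \<not> left_complement G A' B"
    using min unfolding minimal_left_complement_def by auto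
  have AB: "A \<subseteq> carrier G" "B \<subseteq> carrier G" "B \<noteq> {}" "A <#> B = carrier G"
    using lc unfolding left_complement_def by auto
  have "\<forall>a\<in>A. \<exists>b. b \<in> B \<and> (\<forall>a'\<in>A. \<forall>b'\<in>B. a \<otimes> b = a' \<otimes> b' \<longrightarrow> a' = a)"
  proof
    fix a assume a: "a \<in> A"
    have "(A - {a}) <#> B \<noteq> carrier G"
    proof
      assume eq: "(A - {a}) <#> B = carrier G"
      \<comment> \<open>\<open>left_complement\<close> demands nonempty sets, so this must be
        settled before minimality applies.\<close>
      then have "A - {a} \<noteq> {}" using one_closed by (force simp: set_mult_def)
      then have "left_complement G (A - {a}) B"
        using eq AB unfolding left_complement_def by auto
      then show False using mn a by blast
    qed
    moreover have "(A - {a}) <#> B \<subseteq> carrier G"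
      using AB by (intro set_mult_closed) auto
    ultimately obtain g where g: "g \<in> carrier G" "g \<notin> (A - {a}) <#> B" by blast
    have u: "\<forall>a'\<in>A. \<forall>b\<in>B. g = a' \<otimes> b \<longrightarrow> a' = a"
      using g(2) unfolding set_mult_def by blast
    have "g \<in> A <#> B" using g AB by simp
    then obtain a' b where "a' \<in> A" "b \<in> B" "g = a' \<otimes> b" unfolding set_mult_def by blast
    then show "\<exists>b. b \<in> B \<and> (\<forall>a'\<in>A. \<forall>b'\<in>B. a \<otimes> b = a' \<otimes> b' \<longrightarrow> a' = a)"
      using u by blast
  qed
  from bchoice[OF this] show ?thesis using that by blast
qed

text \<open>Since \<open>A \<noteq> H\<close>, at least two elements of \<open>B\<close> are needed to cover each right coset of \<open>H\<close>;
  \<open>Z\<close> collects two for each coset.\<close>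

lemma (in group) two_translates_per_coset:
  assumes H: "subgroup H G" and fin: "finite (rcosets H)"
    and A: "A \<subset> H" and lc: "left_complement G A B"
  obtains Z where "Z \<subseteq> B" "finite Z" "card Z \<le> 2 * card (rcosets H)"
    "\<And>g b. \<lbrakk>g \<in> carrier G; b \<in> B\<rbrakk> \<Longrightarrow> \<exists>z\<in>Z. z \<noteq> b \<and> g \<otimes> inv z \<in> H"
proof -
  have AB: "A \<subseteq> carrier G" "B \<subseteq> carrier G" "A <#> B = carrier G"
    using lc unfolding left_complement_def by auto
  have Hc: "H \<subseteq> carrier G" using H by (rule subgroup.subset)
  have cover: "\<exists>a\<in>A. \<exists>b\<in>B. g = a \<otimes> b" if "g \<in> carrier G" for g
    using that AB(3) unfolding set_mult_def by blast
  have "\<exists>x y. x \<in> B \<and> y \<in> B \<and> x \<noteq> y \<and> (\<forall>g\<in>Y. g \<otimes> inv x \<in> H \<and> g \<otimes> inv y \<in> H)"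
    if Y: "Y \<in> rcosets H" for Y
  proof -
    obtain g where g: "g \<in> carrier G" "Y = H #> g" using Y unfolding RCOSETS_def by blast
    obtain a x where x: "a \<in> A" "x \<in> B" "g = a \<otimes> x" using cover g by blast
    \<comment> \<open>The second element comes from covering \<open>h \<otimes> x\<close> as
      \<open>a' \<otimes> y\<close>: if \<open>y = x\<close>, cancellation would give
      \<open>h = a' \<in> A\<close>. As \<open>h\<close> and \<open>a'\<close> lie in
      \<open>H\<close>, \<open>y\<close> stays in the coset of \<open>x\<close>.\<close>
    obtain h where h: "h \<in> H" "h \<notin> A" using A by blast
    have xc: "x \<in> carrier G" and ac: "a \<in> H" "a \<in> carrier G" and hc: "h \<in> carrier G"
      using x AB A Hc h by auto
    obtain a' y where y: "a' \<in> A" "y \<in> B" "h \<otimes> x = a' \<otimes> y"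
      using cover[of "h \<otimes> x"] hc xc by blast
    have yc: "y \<in> carrier G" and a'c: "a' \<in> H" "a' \<in> carrier G" using y AB A by auto
    have "x \<noteq> y" using y h hc xc a'c by (metis right_cancel)
    moreover have "H #> x = Y"
      unfolding g x using rcos_mult_left[OF H ac(1) xc] by simp
    moreover have "H #> y = Y"
      using rcos_mult_left[OF H a'c(1) yc] rcos_mult_left[OF H h(1) xc] y(3) \<open>H #> x = Y\<close> by simp
    moreover have "g' \<otimes> inv z \<in> H" if z: "H #> z = Y" "z \<in> carrier G" "g' \<in> Y" for g' z
    proof -
      obtain h' where "h' \<in> H" "g' = h' \<otimes> z"
        using z(3) unfolding z(1)[symmetric] r_coset_def by blast
      then show ?thesis using z(2) Hc by (auto simp: m_assoc)
    qed
    ultimately show ?thesis using x y xc yc by blast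
  qed
  then obtain x y where xy: "\<And>Y. Y \<in> rcosets H \<Longrightarrow> x Y \<in> B \<and> y Y \<in> B \<and> x Y \<noteq> y Y \<and>
      (\<forall>g\<in>Y. g \<otimes> inv x Y \<in> H \<and> g \<otimes> inv y Y \<in> H)"
    by metis
  show ?thesis
  proof (rule that[of "x ` (rcosets H) \<union> y ` (rcosets H)"])
    show "x ` (rcosets H) \<union> y ` (rcosets H) \<subseteq> B" using xy by blast
    show "finite (x ` (rcosets H) \<union> y ` (rcosets H))" using fin by simp
    have "card (x ` (rcosets H) \<union> y ` (rcosets H)) \<le> card (x ` (rcosets H)) + card (y ` (rcosets H))"
      by (rule card_Un_le)
    then show "card (x ` (rcosets H) \<union> y ` (rcosets H)) \<le> 2 * card (rcosets H)"
      using card_image_le[OF fin, of x] card_image_le[OF fin, of y] by linarith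
    fix g b assume g: "g \<in> carrier G" and b: "b \<in> B"
    have "H #> g \<in> rcosets H" "g \<in> H #> g"
      using g H by (auto simp: RCOSETS_def rcos_self)
    \<comment> \<open>At most one of the two elements chosen for the coset of \<open>g\<close>
      equals \<open>b\<close>.\<close>
    then show "\<exists>z\<in>x ` (rcosets H) \<union> y ` (rcosets H). z \<noteq> b \<and> g \<otimes> inv z \<in> H"
      using xy[of "H #> g"] by (metis UnI1 UnI2 image_eqI)
  qed
qed

section \<open>The counting argument for left complements\<close>

text \<open>The cosets of \<open>K\<close> are counted as images under \<open>(#>) K\<close>, and
  \<open>C\<close> enters as a set stable under left multiplication by \<open>K\<close>. In this
  form the result can be applied to \<open>C\<close> and also to the set of inverses of
  \<open>C\<close>.\<close>

lemma (in group) not_minimal_left_complement: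
  assumes H: "subgroup H G" and finH: "finite (rcosets H)"
    and K: "subgroup K G" and CH: "C \<subseteq> H"
    and KC: "\<And>k c. \<lbrakk>k \<in> K; c \<in> C\<rbrakk> \<Longrightarrow> k \<otimes> c \<in> C"
    and finD: "finite ((#>) K ` (H - C))"
    and manyC: "more_than ((#>) K ` C) (2 * card (rcosets H) * card ((#>) K ` (H - C)))"
    and E: "finite E" "E \<subseteq> C" and F: "F \<subset> H - C"
    and bigK: "more_than K (2 * (card (rcosets H) + 1) * card E)"
  shows "\<not> minimal_left_complement G ((C - E) \<union> F) B"
proof
  define n where "n = card (rcosets H)"
  define q where "q = (#>) K"
  define d where "d = card (q ` (H - C))"
  define A where "A = (C - E) \<union> F"
  assume "minimal_left_complement G ((C - E) \<union> F) B"
  then have min: "minimal_left_complement G A B" by (simp add: A_def)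
  then have lc: "left_complement G A B" unfolding minimal_left_complement_def by blast
  have AH: "A \<subset> H" and CA: "C - E \<subseteq> A" and HA: "H - A \<subseteq> (H - C) \<union> E"
    using CH E F by (auto simp: A_def)
  have Hc: "H \<subseteq> carrier G" using H by (rule subgroup.subset)
  have Kc: "K \<subseteq> carrier G" using K by (rule subgroup.subset)
  have Ac: "A \<subseteq> carrier G" and Cc: "C \<subseteq> carrier G"
    using AH CH Hc by auto
  have Bc: "B \<subseteq> carrier G" using lc unfolding left_complement_def by blast
  obtain \<beta> where \<beta>: "\<And>a. a \<in> A \<Longrightarrow> \<beta> a \<in> B"
    and u: "\<And>a a' b. \<lbrakk>a \<in> A; a' \<in> A; b \<in> B; a \<otimes> \<beta> a = a' \<otimes> b\<rbrakk> \<Longrightarrow> a' = a"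
    using private_products[OF min] by blast
  define p where "p a = a \<otimes> \<beta> a" for a
  have p: "\<beta> a \<in> B \<and> p a = a \<otimes> \<beta> a" if "a \<in> A" for a
    using \<beta> that by (simp add: p_def)
  have uniq: "a' = a" if "a \<in> A" "a' \<in> A" "b \<in> B" "p a = a' \<otimes> b" for a a' b
    using u that by (simp add: p_def)
  have pc: "p a \<in> carrier G" if "a \<in> A" for a using p[OF that] that Ac Bc by auto
  have inj: "inj_on p A"
    by (rule inj_onI) (metis p uniq)
  obtain Z where Z: "Z \<subseteq> B" "finite Z" "card Z \<le> 2 * n"
    and Zc: "\<And>g b. \<lbrakk>g \<in> carrier G; b \<in> B\<rbrakk> \<Longrightarrow> \<exists>z\<in>Z. z \<noteq> b \<and> g \<otimes> inv z \<in> H"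
    using two_translates_per_coset[OF H finH AH lc] unfolding n_def by metis
  \<comment> \<open>Take \<open>z \<in> Z\<close> other than \<open>\<beta> a\<close> with
    \<open>p a \<otimes> inv z\<close> in \<open>H\<close>. If this element were in
    \<open>A\<close>, privacy would make it \<open>a\<close> and hence \<open>z = \<beta> a\<close>.
    So it lies in \<open>H - A\<close>.\<close>
  have loc: "\<exists>z\<in>Z. \<exists>h\<in>(H - C) \<union> E. p a = h \<otimes> z" if a: "a \<in> A" for a
  proof -
    obtain z where z: "z \<in> Z" "z \<noteq> \<beta> a" "p a \<otimes> inv z \<in> H" using Zc[OF pc[OF a]] p[OF a] by metis
    have zc: "z \<in> carrier G" "z \<in> B" using z Z Bc by auto
    have eq: "p a = (p a \<otimes> inv z) \<otimes> z" using pc[OF a] zc by (simp add: m_assoc)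
    have "p a \<otimes> inv z \<notin> A"
    proof
      assume "p a \<otimes> inv z \<in> A"
      then have "p a \<otimes> inv z = a" using uniq[OF a _ zc(2) eq] by simp
      then have "a \<otimes> \<beta> a = a \<otimes> z" using eq p[OF a] by simp
      then show False using z zc a Ac Bc p[OF a] by (metis Units_eq Units_l_cancel subsetD)
    qed
    then show ?thesis using z eq HA by blast
  qed
  \<comment> \<open>\<open>EE\<close> is the product set \<open>EZ\<close>; \<open>V\<close> is the
    set of right cosets of \<open>K\<close> that make up \<open>(H - C)Z\<close>.\<close>
  define EE where "EE = (\<Union>z\<in>Z. (\<lambda>e. e \<otimes> z) ` E)"
  define V where "V = (\<Union>z\<in>Z. (\<lambda>Y. Y #> z) ` q ` (H - C))"
  have finEE: "finite EE" unfolding EE_def using Z E by blast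
  have finV: "finite V" unfolding V_def using Z finD unfolding q_def by blast
  have "card EE \<le> (\<Sum>z\<in>Z. card ((\<lambda>e. e \<otimes> z) ` E))" unfolding EE_def using Z(2) by (rule card_UN_le)
  also have "\<dots> \<le> card Z * card E" using sum_bounded_above[of Z "\<lambda>z. card ((\<lambda>e. e \<otimes> z) ` E)" "card E"]
    by (simp add: card_image_le E)
  also have "\<dots> \<le> 2 * n * card E" using Z(3) by (rule mult_le_mono1)
  finally have cardEE: "card EE \<le> 2 * n * card E" .
  have "card V \<le> (\<Sum>z\<in>Z. card ((\<lambda>Y. Y #> z) ` q ` (H - C)))"
    unfolding V_def using Z(2) by (rule card_UN_le)
  also have "\<dots> \<le> card Z * d"
    using sum_bounded_above[of Z "\<lambda>z. card ((\<lambda>Y. Y #> z) ` q ` (H - C))" d] finD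
    by (simp add: card_image_le d_def q_def)
  also have "\<dots> \<le> 2 * n * d" using Z(3) by (rule mult_le_mono1)
  finally have cardV: "card V \<le> 2 * n * d" .
  have loc': "p a \<in> EE \<or> q (p a) \<in> V" if "a \<in> A" for a
  proof -
    obtain z h where zh: "z \<in> Z" "h \<in> (H - C) \<union> E" "p a = h \<otimes> z" using loc[OF \<open>a \<in> A\<close>] by blast
    show ?thesis
    proof (cases "h \<in> E")
      case True
      then show ?thesis using zh unfolding EE_def by blast
    next
      case False
      then have h: "h \<in> H - C" using zh by blast
      have "q (p a) = q h #> z"
        unfolding q_def zh(3) using h zh(1) Z Hc Bc Kc by (subst coset_mult_assoc) auto
      then show ?thesis using h zh(1) unfolding V_def by blast
    qed
  qed
  \<comment> \<open>Write
    \<open>p a' = k \<otimes> p a = (k \<otimes> a) \<otimes> \<beta> a\<close> with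
    \<open>k \<in> K\<close>. The element \<open>k \<otimes> a\<close> is in \<open>C\<close> and in
    the coset of \<open>a\<close>, so it is not \<open>a'\<close>. Since \<open>p a'\<close> is
    private to \<open>a'\<close>, it cannot lie in \<open>A\<close>, which leaves
    \<open>E\<close>.\<close>
  have key: "\<exists>e\<in>E. p a' = e \<otimes> \<beta> a"
    if a: "a \<in> C - E" and a': "a' \<in> C - E" and qp: "q (p a) = q (p a')" and ne: "q a \<noteq> q a'" for a a'
  proof -
    have aA: "a \<in> A" "a' \<in> A" using a a' CA by auto
    obtain k where k: "k \<in> K" "p a' = k \<otimes> p a"
      using rcos_eqD[OF K pc[OF aA(1)] pc[OF aA(2)]] qp unfolding q_def by metis
    have eq: "p a' = (k \<otimes> a) \<otimes> \<beta> a"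
      using k p[OF aA(1)] aA Ac Bc Kc by (simp add: m_assoc subset_iff)
    have "k \<otimes> a \<noteq> a'"
      using ne rcos_mult_left[OF K k(1), of a] aA Ac unfolding q_def by auto
    then have "k \<otimes> a \<notin> A" using uniq[OF aA(2) _ _ eq] p[OF aA(1)] by blast
    then have "k \<otimes> a \<in> E" using KC[OF k(1), of a] a CA by blast
    then show ?thesis using eq by blast
  qed
  \<comment> \<open>\<open>T1\<close> holds the unambiguous cosets, including those that receive no
    private product from \<open>C - E\<close>; \<open>T2\<close> holds the ambiguous ones.
    \<open>W Y\<close> collects the private products falling in \<open>Y\<close>.\<close>
  define T1 where "T1 = {Y \<in> V. \<forall>a\<in>C - E. \<forall>a'\<in>C - E. q (p a) = Y \<longrightarrow> q (p a') = Y \<longrightarrow> q a = q a'}"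
  define T2 where "T2 = V - T1"
  define W where "W Y = {g \<in> p ` (C - E). q g = Y}" for Y
  have fT: "finite T1" "finite T2" using finV by (auto simp: T1_def T2_def)
  have "card T1 + card T2 = card V"
    using finV by (simp add: T2_def T1_def card_Diff_subset card_mono)
  with cardV have cT: "card T1 + card T2 \<le> 2 * n * d" by simp
  have WY: "finite (W Y) \<and> card (W Y) \<le> 2 * card E" if "Y \<in> T2" for Y
  proof -
    obtain a1 a2 where a: "a1 \<in> C - E" "a2 \<in> C - E" "q (p a1) = Y" "q (p a2) = Y" "q a1 \<noteq> q a2"
      using \<open>Y \<in> T2\<close> unfolding T2_def T1_def by blast
    \<comment> \<open>The coset of any \<open>a'\<close> differs from that of \<open>a1\<close> or
      from that of \<open>a2\<close>, so \<open>key\<close> applies with one of the two.\<close>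
    have sub: "W Y \<subseteq> (\<lambda>e. e \<otimes> \<beta> a1) ` E \<union> (\<lambda>e. e \<otimes> \<beta> a2) ` E"
    proof
      fix g assume "g \<in> W Y"
      then obtain a' where a': "a' \<in> C - E" "g = p a'" "q (p a') = Y" unfolding W_def by blast
      show "g \<in> (\<lambda>e. e \<otimes> \<beta> a1) ` E \<union> (\<lambda>e. e \<otimes> \<beta> a2) ` E"
      proof (cases "q a1 = q a'")
        case True
        then show ?thesis using key[OF a(2) a'(1)] a a' by fastforce
      next
        case False
        then show ?thesis using key[OF a(1) a'(1)] a a' by fastforce
      qed
    qed
    have fin: "finite ((\<lambda>e. e \<otimes> \<beta> a1) ` E \<union> (\<lambda>e. e \<otimes> \<beta> a2) ` E)" using E by simp
    have "card ((\<lambda>e. e \<otimes> \<beta> a1) ` E \<union> (\<lambda>e. e \<otimes> \<beta> a2) ` E) \<le> card E + card E"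
      by (rule order_trans[OF card_Un_le add_mono]) (simp_all add: card_image_le E)
    then show ?thesis using card_mono[OF fin sub] finite_subset[OF sub fin] by simp
  qed
  \<comment> \<open>These cosets of \<open>C\<close> send some private product into
    \<open>T1\<close>. An unambiguous target determines its source coset, so there are at most
    \<open>card T1\<close> of them.\<close>
  define X1 where "X1 = {X \<in> q ` C. \<exists>a\<in>C - E. q a = X \<and> q (p a) \<in> T1}"
  obtain r where r: "\<And>X. X \<in> X1 \<Longrightarrow> r X \<in> C - E \<and> q (r X) = X \<and> q (p (r X)) \<in> T1"
  proof -
    have "\<forall>X\<in>X1. \<exists>a. a \<in> C - E \<and> q a = X \<and> q (p a) \<in> T1" unfolding X1_def by blast
    from bchoice[OF this] show ?thesis using that by blast
  qed
  have inj1: "inj_on (\<lambda>X. q (p (r X))) X1"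
  proof (rule inj_onI)
    fix X X' assume X: "X \<in> X1" "X' \<in> X1" "q (p (r X)) = q (p (r X'))"
    then have "q (r X) = q (r X')" using r[OF X(1)] r[OF X(2)] unfolding T1_def by blast
    then show "X = X'" using r X by metis
  qed
  have im1: "(\<lambda>X. q (p (r X))) ` X1 \<subseteq> T1" using r by blast
  have finX1: "finite X1" using inj_on_finite[OF inj1 im1 fT(1)] .
  have cardX1: "card X1 \<le> card T1" using card_inj_on_le[OF inj1 im1 fT(1)] .
  have X1C: "X1 \<subseteq> q ` C" unfolding X1_def by blast
  \<comment> \<open>If \<open>C\<close> has finitely many cosets, their number exceeds
    \<open>2 * n * d\<close>, which bounds \<open>card T1 + card T2\<close>; removing at most
    \<open>card T1\<close> leaves more than \<open>card T2\<close>.\<close>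
  have "infinite (q ` C - X1) \<or> card T2 + 1 \<le> card (q ` C - X1)"
  proof (cases "finite (q ` C)")
    case True
    then have "2 * n * d < card (q ` C)"
      using manyC unfolding more_than_def q_def n_def d_def by simp
    then show ?thesis using True cT cardX1 card_Diff_subset[OF finX1 X1C] by linarith
  next
    case False
    then show ?thesis using finX1 by simp
  qed
  then obtain S where S: "S \<subseteq> q ` C - X1" "finite S" "card S = card T2 + 1"
    by (metis infinite_arbitrarily_large obtain_subset_with_card_n)
  have SC: "\<Union>S \<subseteq> C" using S(1) KC unfolding q_def r_coset_def by auto
  have Sr: "S \<subseteq> rcosets K" using S(1) Cc unfolding q_def RCOSETS_def by blast
  \<comment> \<open>Cosets in \<open>S\<close> avoid \<open>X1\<close>, so a private product outside
    \<open>EE\<close> can only fall in an ambiguous coset.\<close>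
  have pU: "p ` (\<Union>S - E) \<subseteq> EE \<union> (\<Union>Y\<in>T2. W Y)"
  proof
    fix g assume "g \<in> p ` (\<Union>S - E)"
    then obtain a X where a: "g = p a" "a \<in> X" "X \<in> S" "a \<notin> E" by blast
    have aC: "a \<in> C - E" using a SC by blast
    obtain c where "c \<in> C" "X = K #> c" using a(3) S(1) unfolding q_def by blast
    then have "q a = X" using a(2) Cc K repr_independence[of a K c] unfolding q_def by auto
    then have "q (p a) \<notin> T1" using S(1) a aC unfolding X1_def by blast
    then show "g \<in> EE \<union> (\<Union>Y\<in>T2. W Y)"
      using loc'[of a] aC CA a unfolding T2_def W_def by blast
  qed
  have finR: "finite (EE \<union> (\<Union>Y\<in>T2. W Y))" using finEE fT WY by blast
  have injU: "inj_on p (\<Union>S - E)" using inj by (rule inj_on_subset) (use SC CA in blast)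
  have finU: "finite (\<Union>S - E)" using inj_on_finite[OF injU pU finR] .
  have "card (\<Union>S - E) \<le> card (EE \<union> (\<Union>Y\<in>T2. W Y))" using card_inj_on_le[OF injU pU finR] .
  also have "\<dots> \<le> card EE + card (\<Union>Y\<in>T2. W Y)" by (rule card_Un_le)
  also have "\<dots> \<le> 2 * n * card E + card T2 * (2 * card E)"
  proof (rule add_mono[OF cardEE])
    have "card (\<Union>Y\<in>T2. W Y) \<le> (\<Sum>Y\<in>T2. card (W Y))" using fT(2) by (rule card_UN_le)
    also have "\<dots> \<le> card T2 * (2 * card E)"
      using sum_bounded_above[of T2 "\<lambda>Y. card (W Y)" "2 * card E"] WY by simp
    finally show "card (\<Union>Y\<in>T2. W Y) \<le> card T2 * (2 * card E)" .
  qed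
  finally have cU: "card (\<Union>S - E) \<le> 2 * n * card E + card T2 * (2 * card E)" .
  have finS: "finite (\<Union>S)" using finU E(1) by simp
  have "card (\<Union>S) \<le> card (\<Union>S - E) + card E"
    using diff_card_le_card_Diff[OF E(1), of "\<Union>S"] by linarith
  then have up: "card (\<Union>S) \<le> 2 * n * card E + card T2 * (2 * card E) + card E" using cU by linarith
  obtain X where X: "X \<in> S" using S by fastforce
  have cX: "card X = card K" "finite X" if "X \<in> S" for X
    using that Sr card_rcosets_equal[of X K] Kc finS by (auto intro: finite_subset[OF Union_upper])
  \<comment> \<open>A coset \<open>X \<in> S\<close> is finite and equinumerous with
    \<open>K\<close>. This excludes the infinite alternative in \<open>more_than\<close>.\<close>
  have "finite K"
  proof -
    obtain c where c: "c \<in> carrier G" "X = K #> c" using X Sr unfolding RCOSETS_def by blast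
    have "inj_on (\<lambda>k. k \<otimes> c) K" using inj_on_g[OF Kc c(1)] .
    moreover have "X = (\<lambda>k. k \<otimes> c) ` K" unfolding c r_coset_def by blast
    ultimately show ?thesis using cX(2)[OF X] finite_imageD by blast
  qed
  \<comment> \<open>The \<open>+ 1\<close> from strictness is what yields the contradiction when
    \<open>E\<close> is empty.\<close>
  then have cK: "2 * (n + 1) * card E + 1 \<le> card K" using bigK unfolding more_than_def n_def by simp
  have "card (\<Union>S) = card S * card K"
  proof -
    have "pairwise disjnt S"
      using rcos_disjoint[OF K] Sr by (rule pairwise_subset)
    then have "card (\<Union>S) = sum card S" using cX by (intro card_Union_disjoint) auto
    then show ?thesis using cX by simp
  qed
  also have "\<dots> \<ge> (card T2 + 1) * (2 * (n + 1) * card E + 1)"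
    unfolding S(3) using cK by (rule mult_le_mono2)
  finally have "(card T2 + 1) * (2 * (n + 1) * card E + 1)
      \<le> 2 * n * card E + card T2 * (2 * card E) + card E" using up by linarith
  \<comment> \<open>The lower bound for \<open>card (\<Union>S)\<close> is the upper bound plus a
    positive remainder.\<close>
  moreover have "(card T2 + 1) * (2 * (n + 1) * card E + 1)
      = 2 * n * card E + card T2 * (2 * card E) + card E + (2 * (card T2 * n * card E) + card E + card T2 + 1)"
    by (simp add: algebra_simps)
  ultimately show False by linarith
qed

section \<open>Inversion exchanges left and right complements\<close>

lemma (in group) image_inv_set_mult:
  assumes "A \<subseteq> carrier G" "B \<subseteq> carrier G"
  shows "m_inv G ` (A <#> B) = (m_inv G ` B) <#> (m_inv G ` A)"
  using assms unfolding set_mult_def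
  by (force simp: inv_mult_group subset_iff image_iff)

lemma (in group) image_inv_inv:
  "A \<subseteq> carrier G \<Longrightarrow> m_inv G ` m_inv G ` A = A"
  by (force simp: subset_iff image_iff)

lemma (in group) left_complement_image_inv:
  assumes "right_complement G A B"
  shows "left_complement G (m_inv G ` A) (m_inv G ` B)"
proof -
  have "m_inv G ` carrier G = carrier G"
    by (force simp: image_iff intro: inv_inv[symmetric])
  then show ?thesis
    using assms image_inv_set_mult[of B A]
    unfolding left_complement_def right_complement_def by (metis image_is_empty image_mono)
qed

lemma (in group) right_complement_image_inv:
  assumes "left_complement G A B"
  shows "right_complement G (m_inv G ` A) (m_inv G ` B)"
proof -
  have "m_inv G ` carrier G = carrier G"
    by (force simp: image_iff intro: inv_inv[symmetric])
  then show ?thesis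
    using assms image_inv_set_mult[of A B]
    unfolding left_complement_def right_complement_def by (metis image_is_empty image_mono)
qed

text \<open>A smaller left complement to the inverse of \<open>B\<close> would, inverted back, be a
  smaller right complement to \<open>B\<close>.\<close>

lemma (in group) minimal_left_complement_image_inv:
  assumes "minimal_right_complement G A B"
  shows "minimal_left_complement G (m_inv G ` A) (m_inv G ` B)"
  unfolding minimal_left_complement_def
proof (intro conjI allI impI notI)
  have rc: "right_complement G A B" using assms unfolding minimal_right_complement_def by blast
  then show "left_complement G (m_inv G ` A) (m_inv G ` B)" by (rule left_complement_image_inv)
  have AB: "A \<subseteq> carrier G" "B \<subseteq> carrier G" using rc unfolding right_complement_def by auto
  fix A' assume sub: "A' \<subset> m_inv G ` A" and "left_complement G A' (m_inv G ` B)"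
  then have "right_complement G (m_inv G ` A') B"
    using right_complement_image_inv image_inv_inv[OF AB(2)] by metis
  moreover have "m_inv G ` A' \<subset> A"
  proof
    show "m_inv G ` A' \<subseteq> A" using sub image_inv_inv[OF AB(1)] by blast
    have "A' \<subseteq> carrier G" using sub AB(1) by auto
    then show "m_inv G ` A' \<noteq> A" using sub image_inv_inv by blast
  qed
  ultimately show False using assms unfolding minimal_right_complement_def by blast
qed

section \<open>Both kinds of complement in the original setting\<close>

theorem theorem2p4:
  fixes G :: "('a, 'b) monoid_scheme" (structure)
    and H K C E F :: "'a set"
  assumes "group G"
    and "finite_index_subgroup G H"
    and "K \<lhd> (G\<lparr>carrier := H\<rparr>)"
    and "C \<subset> H"
    and "\<exists>S. S \<subseteq> rcosets K \<and> C = \<Union>S"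
    and "\<exists>S. finite S \<and> S \<subseteq> rcosets K \<and> H - C = \<Union>S"
    and "more_than (rcosets_within G K C)
           (2 * subgroup_index G H * card (rcosets_within G K (H - C)))"
    and "finite E" and "E \<subseteq> C"
    and "F \<subseteq> H - C"
    and "F \<noteq> H - C"
    and "\<forall>x y :: nat \<Rightarrow> 'a.
           (\<forall>i\<in>{1..subgroup_index G H}. x i \<in> carrier G \<and> y i \<in> carrier G \<and> x i \<noteq> y i) \<longrightarrow>
           (\<exists>L. finite_index_subgroup (G\<lparr>carrier := K\<rparr>) L \<and> L \<lhd> (G\<lparr>carrier := H\<rparr>) \<and>
                (\<forall>i\<in>{1..subgroup_index G H}. L #> x i \<noteq> L #> y i))"
    and "\<forall>L. finite_index_subgroup (G\<lparr>carrier := K\<rparr>) L \<longrightarrow>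
           more_than L (2 * (subgroup_index G H + 1) * card E)"
  shows "\<not> minimal_complement G ((C - E) \<union> F)"
proof -
  interpret group G by fact
  have H: "subgroup H G" and finH: "finite (rcosets H)"
    using assms(2) by (auto simp: finite_index_subgroup_def)
  have Hc: "H \<subseteq> carrier G" using H by (rule subgroup.subset)
  interpret N: normal K "G\<lparr>carrier := H\<rparr>" by fact
  have K: "subgroup K G" using incl_subgroup[OF H] N.subgroup_axioms by blast
  have KH: "K \<subseteq> H" using N.subset by simp
  have Kc: "K \<subseteq> carrier G" using KH Hc by blast
  have conj: "h \<otimes> k \<otimes> inv h \<in> K" if "k \<in> K" "h \<in> H" for h k
    using N.inv_op_closed2[of h k] that m_inv_consistent[OF H] by simp
  have mem: "D = K #> c" if "D \<in> rcosets K" "c \<in> D" for D c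
    using that K unfolding RCOSETS_def by (auto dest: repr_independence)
  \<comment> \<open>When \<open>S\<close> is a union of cosets, the cosets contained in
    \<open>S\<close> are exactly those of its elements.\<close>
  have within: "rcosets_within G K S = (#>) K ` S"
    if exT: "\<exists>T. T \<subseteq> rcosets K \<and> S = \<Union>T" for S
  proof -
    obtain T where T: "T \<subseteq> rcosets K" "S = \<Union>T" using exT by blast
    have ne: "\<exists>c. c \<in> D" if "D \<in> rcosets K" for D
      using that rcos_self[OF _ K] unfolding RCOSETS_def by auto
    show ?thesis
    proof
      show "rcosets_within G K S \<subseteq> (#>) K ` S"
      proof
        fix D assume "D \<in> rcosets_within G K S"
        then have D: "D \<in> rcosets K" "D \<subseteq> S" unfolding rcosets_within_def by auto
        obtain c where "c \<in> D" using ne[OF D(1)] by blast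
        then show "D \<in> (#>) K ` S" using mem[OF D(1)] D(2) by auto
      qed
      show "(#>) K ` S \<subseteq> rcosets_within G K S"
      proof
        fix D assume "D \<in> (#>) K ` S"
        then obtain c D' where c: "D = K #> c" "c \<in> D'" "D' \<in> T" using T by blast
        then have "D = D'" using mem[of D' c] T by auto
        then show "D \<in> rcosets_within G K S" using c T unfolding rcosets_within_def by blast
      qed
    qed
  qed
  have Cc: "C \<subseteq> carrier G" and CH: "C \<subseteq> H" using assms(4) Hc by auto
  have finD: "finite ((#>) K ` (H - C))"
  proof -
    obtain T where T: "finite T" "T \<subseteq> rcosets K" "H - C = \<Union>T" using assms(6) by blast
    have "(#>) K ` (H - C) \<subseteq> T"
    proof
      fix D assume "D \<in> (#>) K ` (H - C)"
      then obtain c D' where c: "D = K #> c" "c \<in> D'" "D' \<in> T" using T(3) by blast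
      then show "D \<in> T" using mem[of D' c] T(2) by auto
    qed
    then show ?thesis using T(1) finite_subset by blast
  qed
  have qD: "rcosets_within G K (H - C) = (#>) K ` (H - C)" using assms(6) by (intro within) blast
  have qC: "rcosets_within G K C = (#>) K ` C" using assms(5) by (intro within)
  have KC: "k \<otimes> c \<in> C" if kc: "k \<in> K" "c \<in> C" for k c
  proof -
    obtain D where D: "D \<in> rcosets K" "c \<in> D" "D \<subseteq> C" using assms(5) kc(2) by blast
    then show ?thesis using mem[OF D(1,2)] kc(1) unfolding r_coset_def by blast
  qed
  have manyC: "more_than ((#>) K ` C) (2 * card (rcosets H) * card ((#>) K ` (H - C)))"
    using assms(7) unfolding qC qD subgroup_index_def .
  \<comment> \<open>This is condition (2) with \<open>L = K\<close>, whose only coset in itself is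
    \<open>K\<close>.\<close>
  have bigK: "more_than K (2 * (card (rcosets H) + 1) * card E)"
  proof -
    have gK: "group (G\<lparr>carrier := K\<rparr>)" using K subgroup_imp_group by blast
    have "rcosets\<^bsub>G\<lparr>carrier := K\<rparr>\<^esub> K \<subseteq> {K}"
      using group.coset_join2[OF gK _ group.subgroup_self[OF gK]] unfolding RCOSETS_def by auto
    then have "finite_index_subgroup (G\<lparr>carrier := K\<rparr>) K"
      using group.subgroup_self[OF gK] finite_subset unfolding finite_index_subgroup_def by auto
    then show ?thesis using assms(13) unfolding subgroup_index_def by blast
  qed
  have F: "F \<subset> H - C" using assms(10,11) by blast
  have "\<not> minimal_left_complement G ((C - E) \<union> F) B" for B
    by (rule not_minimal_left_complement[OF H finH K CH KC finD manyC assms(8,9) F bigK])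
  moreover have "\<not> minimal_right_complement G ((C - E) \<union> F) B" for B
  proof
    assume "minimal_right_complement G ((C - E) \<union> F) B"
    then have *: "minimal_left_complement G (m_inv G ` ((C - E) \<union> F)) (m_inv G ` B)"
      by (rule minimal_left_complement_image_inv)
    have injinv: "inj_on (m_inv G) (carrier G)" by (rule inj_onI) (metis inv_inv)
    have invH: "m_inv G ` H = H"
      using H image_inv_inv[OF Hc] subgroup.m_inv_closed[OF H] by blast
    have dif: "m_inv G ` (S - T) = m_inv G ` S - m_inv G ` T"
      if "S \<subseteq> carrier G" "T \<subseteq> carrier G" for S T
      using inj_on_image_set_diff[OF injinv] that by blast
    \<comment> \<open>Inversion turns \<open>K #> c\<close> into a left coset of \<open>K\<close>,
      and normality in \<open>H\<close> makes it a right coset again. Hence inversion permutes the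
      right cosets of \<open>K\<close> in \<open>H\<close> and preserves their counts.\<close>
    have invrc: "m_inv G ` (K #> c) = K #> inv c" if "c \<in> H" for c
    proof -
      have sub: "K #> c \<subseteq> H"
        using that KH subgroup.m_closed[OF H] unfolding r_coset_def by blast
      have "m_inv G ` (K #> c) = m_inv (G\<lparr>carrier := H\<rparr>) ` (K #> c)"
        using sub m_inv_consistent[OF H] by (intro image_cong) auto
      also have "\<dots> = K #> inv c"
        using N.rcos_inv[of c] that m_inv_consistent[OF H, of c]
        by (simp add: SET_INV_def r_coset_def UNION_singleton_eq_range)
      finally show ?thesis .
    qed
    have qinv: "(#>) K ` m_inv G ` S = (`) (m_inv G) ` (#>) K ` S" if "S \<subseteq> H" for S
      unfolding image_image by (rule image_cong[OF refl]) (use that invrc in auto)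
    have injim: "inj_on ((`) (m_inv G)) ((#>) K ` S)" if "S \<subseteq> H" for S
    proof (rule inj_on_subset[OF inj_on_image_Pow[OF injinv]])
      show "(#>) K ` S \<subseteq> Pow (carrier G)" using that Hc r_coset_subset_G[OF Kc] by blast
    qed
    have dC: "H - m_inv G ` C = m_inv G ` (H - C)" using dif[OF Hc Cc] invH by simp
    have "\<not> minimal_left_complement G ((m_inv G ` C - m_inv G ` E) \<union> m_inv G ` F) (m_inv G ` B)"
    proof (rule not_minimal_left_complement[OF H finH K])
      show "m_inv G ` C \<subseteq> H" using invH CH by blast
      show "k \<otimes> c \<in> m_inv G ` C" if k: "k \<in> K" and c: "c \<in> m_inv G ` C" for k c
      proof -
        obtain a where a: "a \<in> C" "c = inv a" using c by blast
        have aH: "a \<in> H" and ac: "a \<in> carrier G" and kc: "k \<in> carrier G"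
          using a CH Cc Kc k by auto
        \<comment> \<open>Stability of the inverse set amounts to
          \<open>a \<otimes> inv k \<in> C\<close>; conjugation by \<open>a\<close> moves the factor
          from \<open>K\<close> to the left, where \<open>KC\<close> applies.\<close>
        have "a \<otimes> inv k \<otimes> inv a \<in> K"
          using conj[OF subgroup.m_inv_closed[OF K k] aH] .
        then have "(a \<otimes> inv k \<otimes> inv a) \<otimes> a \<in> C" using KC a(1) by blast
        then have "a \<otimes> inv k \<in> C" using ac kc by (simp add: m_assoc)
        moreover have "k \<otimes> c = inv (a \<otimes> inv k)" using a ac kc by (simp add: inv_mult_group)
        ultimately show ?thesis by blast
      qed
      show "finite ((#>) K ` (H - m_inv G ` C))"
        unfolding dC using finD by (simp add: qinv)
      show "more_than ((#>) K ` m_inv G ` C) (2 * card (rcosets H) * card ((#>) K ` (H - m_inv G ` C)))"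
        using manyC CH unfolding dC more_than_def
        by (simp add: qinv card_image injim finite_image_iff)
      show "finite (m_inv G ` E)" using assms(8) by simp
      show "m_inv G ` E \<subseteq> m_inv G ` C" using assms(9) by blast
      show "m_inv G ` F \<subset> H - m_inv G ` C"
        unfolding dC using F injinv Hc by (metis image_strict_mono inj_on_subset Diff_subset order_trans)
      show "more_than K (2 * (card (rcosets H) + 1) * card (m_inv G ` E))"
        using bigK card_image[of "m_inv G" E] injinv assms(9) Cc by (metis inj_on_subset order_trans)
    qed
    moreover have "m_inv G ` ((C - E) \<union> F) = (m_inv G ` C - m_inv G ` E) \<union> m_inv G ` F"
      using dif[of C E] assms(9) Cc by (simp add: image_Un subset_trans)
    ultimately show False using * by simp
  qed
  ultimately show ?thesis unfolding minimal_complement_def by blast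
qed

end
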